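(* Let $\Gamma$ be a group that is nilpotent of class $\le n$, let $S\subseteq\Gamma\setminus\{\mathbb{I}\}$ be a generating set, $G:=\mathrm{Cay}(\Gamma,S)$, and let $r\ge 2^{n+2}$ be an integer. Let $h\in S$ be such that $\{\mathbb{I},h\}$ is an $r$-local $2$-separator of $G$, and suppose that $G$ has no $r$-local cutvertex. If $h$ is not an involution, then $S\subseteq\{h^{\pm1},h^{\pm2}\}$.
   Context: Generating sets are closed under inverses; $\mathrm{Cay}(\Gamma,S)$ is the simple graph on $\Gamma$ with edges $\{g,gs\}$. $a\equiv b$ means $a=b$ or $a=b^{-1}$; $\Gamma$ is nilpotent of class $\le n$ if $[g,h]_n=\mathbb{I}$ for all $g\not\equiv h$, where $[g,h]_1=gh^{-1}g^{-1}h$ and $[g,h]_n$ is the reduced form of $g[g,h]_{n-1}^{-1}g^{-1}[g,h]_{n-1}$. Ball $B_r(v)$: subgraph of all vertices and edges on closed walks of length $\le r$ through $v$; $v$ is an $r$-local cutvertex if $B_r(v)-v$ is disconnected. For $X=\{v_0,v_1\}$, $N(X)$ is the set of vertices outside $X$ adjacent to $X$; the connectivity graph $C_r(v_0,v_1)$ has vertex set $N(X)$, $a,b$ adjacent if for some $i$ they lie in the same component of $B_r(v_i)-v_0-v_1$; $X$ is an $r$-local $2$-separator if $C_r(v_0,v_1)$ is disconnected and $d_G(v_0,v_1)\le r/2$. *)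

theory Defs
  imports "HOL-Algebra.Algebra"
begin

section \<open>Graphs given by a vertex set V and a symmetric adjacency relation E\<close>

definition walk :: "'a set \<Rightarrow> ('a \<Rightarrow> 'a \<Rightarrow> bool) \<Rightarrow> 'a list \<Rightarrow> bool" where
  "walk V E xs \<longleftrightarrow> xs \<noteq> [] \<and> set xs \<subseteq> V \<and>
     (\<forall>i. Suc i < length xs \<longrightarrow> E (xs ! i) (xs ! Suc i))"

definition walk_edges :: "'a list \<Rightarrow> 'a set set" where
  "walk_edges xs = {{xs ! i, xs ! Suc i} | i. Suc i < length xs}"

text \<open>A closed walk of length at most r through v (length = number of steps).\<close>
definition closed_walk_at :: "'a set \<Rightarrow> ('a \<Rightarrow> 'a \<Rightarrow> bool) \<Rightarrow> nat \<Rightarrow> 'a \<Rightarrow> 'a list \<Rightarrow> bool" where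
  "closed_walk_at V E r v xs \<longleftrightarrow> walk V E xs \<and> hd xs = v \<and> last xs = v \<and> length xs \<le> Suc r"

definition ball_verts :: "'a set \<Rightarrow> ('a \<Rightarrow> 'a \<Rightarrow> bool) \<Rightarrow> nat \<Rightarrow> 'a \<Rightarrow> 'a set" where
  "ball_verts V E r v = \<Union>{set xs | xs. closed_walk_at V E r v xs}"

definition ball_edges :: "'a set \<Rightarrow> ('a \<Rightarrow> 'a \<Rightarrow> bool) \<Rightarrow> nat \<Rightarrow> 'a \<Rightarrow> 'a set set" where
  "ball_edges V E r v = \<Union>{walk_edges xs | xs. closed_walk_at V E r v xs}"

definition conn_in :: "'a set \<Rightarrow> 'a set set \<Rightarrow> 'a \<Rightarrow> 'a \<Rightarrow> bool" where
  "conn_in W F a b \<longleftrightarrow> a \<in> W \<and> b \<in> W \<and> rtranclp (\<lambda>x y. x \<in> W \<and> y \<in> W \<and> {x, y} \<in> F) a b"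

definition disconnected_in :: "'a set \<Rightarrow> 'a set set \<Rightarrow> bool" where
  "disconnected_in W F \<longleftrightarrow> (\<exists>a\<in>W. \<exists>b\<in>W. \<not> conn_in W F a b)"

definition local_cutvertex :: "'a set \<Rightarrow> ('a \<Rightarrow> 'a \<Rightarrow> bool) \<Rightarrow> nat \<Rightarrow> 'a \<Rightarrow> bool" where
  "local_cutvertex V E r v \<longleftrightarrow> v \<in> V \<and>
     disconnected_in (ball_verts V E r v - {v}) {e \<in> ball_edges V E r v. v \<notin> e}"

definition nbhd :: "'a set \<Rightarrow> ('a \<Rightarrow> 'a \<Rightarrow> bool) \<Rightarrow> 'a set \<Rightarrow> 'a set" where
  "nbhd V E A = {u \<in> V - A. \<exists>a\<in>A. E a u}"

definition conn_graph_adj :: "'a set \<Rightarrow> ('a \<Rightarrow> 'a \<Rightarrow> bool) \<Rightarrow> nat \<Rightarrow> 'a \<Rightarrow> 'a \<Rightarrow> 'a \<Rightarrow> 'a \<Rightarrow> bool" where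
  "conn_graph_adj V E r v0 v1 a b \<longleftrightarrow>
     a \<in> nbhd V E {v0, v1} \<and> b \<in> nbhd V E {v0, v1} \<and>
     (\<exists>v\<in>{v0, v1}. conn_in (ball_verts V E r v - {v0, v1})
                             {e \<in> ball_edges V E r v. v0 \<notin> e \<and> v1 \<notin> e} a b)"

definition dist_le :: "'a set \<Rightarrow> ('a \<Rightarrow> 'a \<Rightarrow> bool) \<Rightarrow> 'a \<Rightarrow> 'a \<Rightarrow> nat \<Rightarrow> bool" where
  "dist_le V E u w k \<longleftrightarrow> (\<exists>xs. walk V E xs \<and> hd xs = u \<and> last xs = w \<and> length xs - 1 \<le> k)"

definition local_2_separator :: "'a set \<Rightarrow> ('a \<Rightarrow> 'a \<Rightarrow> bool) \<Rightarrow> nat \<Rightarrow> 'a \<Rightarrow> 'a \<Rightarrow> bool" where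
  "local_2_separator V E r v0 v1 \<longleftrightarrow> v0 \<in> V \<and> v1 \<in> V \<and> v0 \<noteq> v1 \<and>
     (\<exists>a\<in>nbhd V E {v0, v1}. \<exists>b\<in>nbhd V E {v0, v1}. \<not> rtranclp (conn_graph_adj V E r v0 v1) a b) \<and>
     (\<exists>k. dist_le V E v0 v1 k \<and> 2 * k \<le> r)"

definition cayley_adj :: "('a, 'b) monoid_scheme \<Rightarrow> 'a set \<Rightarrow> 'a \<Rightarrow> 'a \<Rightarrow> bool" where
  "cayley_adj G S x y \<longleftrightarrow> x \<in> carrier G \<and> y \<in> carrier G \<and> x \<noteq> y \<and>
     ((\<exists>s\<in>S. y = x \<otimes>\<^bsub>G\<^esub> s) \<or> (\<exists>s\<in>S. x = y \<otimes>\<^bsub>G\<^esub> s))"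

definition generating_set :: "('a, 'b) monoid_scheme \<Rightarrow> 'a set \<Rightarrow> bool" where
  "generating_set G S \<longleftrightarrow> S \<subseteq> carrier G \<and> (\<forall>s\<in>S. inv\<^bsub>G\<^esub> s \<in> S) \<and> generate G S = carrier G"

text \<open>Iterated commutator: iter_comm G k g h = [g,h]_k for k \<ge> 1 (index 0 is an auxiliary seed, equal to h).\<close>
fun iter_comm :: "('a, 'b) monoid_scheme \<Rightarrow> nat \<Rightarrow> 'a \<Rightarrow> 'a \<Rightarrow> 'a" where
  "iter_comm G 0 g h = h"
| "iter_comm G (Suc k) g h =
     g \<otimes>\<^bsub>G\<^esub> inv\<^bsub>G\<^esub> (iter_comm G k g h) \<otimes>\<^bsub>G\<^esub> inv\<^bsub>G\<^esub> g \<otimes>\<^bsub>G\<^esub> iter_comm G k g h"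

definition equiv_inv :: "('a, 'b) monoid_scheme \<Rightarrow> 'a \<Rightarrow> 'a \<Rightarrow> bool" where
  "equiv_inv G a b \<longleftrightarrow> a = b \<or> a = inv\<^bsub>G\<^esub> b"

definition nilpotent_class_le :: "('a, 'b) monoid_scheme \<Rightarrow> nat \<Rightarrow> bool" where
  "nilpotent_class_le G n \<longleftrightarrow>
     (\<forall>g\<in>carrier G. \<forall>h\<in>carrier G. \<not> equiv_inv G g h \<longrightarrow> iter_comm G n g h = \<one>\<^bsub>G\<^esub>)"

end

theory Submission
  imports Defs
begin

text \<open>Call neighbours \<open>a\<close>, \<open>b\<close> of \<open>{\<one>, h}\<close> linked if they lie in the same component of the connectivity
  graph. A cycle of length at most \<open>r\<close> through the edge from \<open>\<one>\<close> to \<open>h\<close> links the vertex before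
  that edge to the vertex after it. Suppose \<open>s \<in> S\<close> is not one of \<open>h\<close>, \<open>inv h\<close>, \<open>h \<otimes> h\<close>,
  \<open>inv (h \<otimes> h)\<close>. The reduced word of the iterated commutator of \<open>h\<close> and \<open>s\<close> is a relator of
  length \<open>2 ^ (n + 1)\<close> in which the letters \<open>s\<close> and \<open>inv s\<close> alternate. A shortest infix of it that
  is a relator is a cycle, and its subwords \<open>s h inv s\<close> and \<open>inv s h s\<close> link \<open>s\<close> to \<open>h \<otimes> s\<close> and
  \<open>inv s\<close> to \<open>h \<otimes> inv s\<close>. The iterated commutator of \<open>h \<otimes> h\<close> and \<open>s\<close>, of length
  \<open>3 * 2 ^ n\<close>, likewise links \<open>s\<close> to \<open>h \<otimes> h\<close> and \<open>inv h\<close> to \<open>h \<otimes> s\<close>. The infix is too short for this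
  only if \<open>s\<close> and \<open>h\<close> commute or one of \<open>s\<close>, \<open>inv s\<close> conjugates \<open>h\<close> to
  \<open>h \<otimes> h\<close> or its inverse, and then the links come from explicit cycles of length at most 8.
  Hence the connectivity graph is connected, so no such \<open>s\<close> exists.\<close>

section \<open>Connectivity graphs\<close>

text \<open>Every step of a closed walk is an edge of the ball, so a segment avoiding
  \<open>T\<close> survives the deletion of \<open>T\<close>. The prefix \<open>p\<close> is
  arbitrary because the induction moves the first vertex of the segment into it while the closed
  walk stays the same.\<close>

lemma closed_walk_segment_conn_in:
  assumes "closed_walk_at V E r v (p @ y # ys @ q)" and "disjnt (set (y # ys)) T"
  shows "conn_in (ball_verts V E r v - T) {e \<in> ball_edges V E r v. disjnt e T} y (last (y # ys))"
  using assms
proof (induction ys arbitrary: p y)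
  case Nil
  then have "y \<in> ball_verts V E r v - T"
    unfolding ball_verts_def by (force simp: disjnt_def)
  then show ?case
    by (simp add: conn_in_def)
next
  case (Cons z zs)
  let ?W = "ball_verts V E r v - T" and ?F = "{e \<in> ball_edges V E r v. disjnt e T}"
  have cw: "closed_walk_at V E r v (p @ y # z # zs @ q)"
    using Cons.prems by simp
  have "{y, z} \<in> walk_edges (p @ y # z # zs @ q)"
    unfolding walk_edges_def
    by (rule CollectI, rule exI[of _ "length p"]) (simp add: nth_append)
  then have "{y, z} \<in> ball_edges V E r v"
    using cw unfolding ball_edges_def by blast
  then have e: "{y, z} \<in> ?F"
    using Cons.prems by (auto simp: disjnt_def)
  have y: "y \<in> ?W"
    using cw Cons.prems(2) unfolding ball_verts_def by (fastforce simp: disjnt_def)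
  have IH: "conn_in ?W ?F z (last (z # zs))"
    using Cons.IH[of "p @ [y]" z] Cons.prems by (simp add: disjnt_def)
  have "rtranclp (\<lambda>x y. x \<in> ?W \<and> y \<in> ?W \<and> {x, y} \<in> ?F) y (last (z # zs))"
    by (rule converse_rtranclp_into_rtranclp[of _ _ z])
      (use e y IH in \<open>simp_all add: conn_in_def\<close>)
  then show ?case
    using y IH by (simp add: conn_in_def)
qed

lemma conn_in_sym:
  assumes "conn_in W F a b"
  shows "conn_in W F b a"
proof -
  have "symp (\<lambda>x y. x \<in> W \<and> y \<in> W \<and> {x, y} \<in> F)"
    by (auto simp: symp_def insert_commute)
  then show ?thesis
    using assms sympD[OF symp_rtranclp[of "\<lambda>x y. x \<in> W \<and> y \<in> W \<and> {x, y} \<in> F"]]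
    unfolding conn_in_def by blast
qed

lemma symp_conn_graph_adj: "symp (conn_graph_adj V E r v0 v1)"
  unfolding symp_def conn_graph_adj_def by (blast intro: conn_in_sym)

lemma conn_graph_adj_closed_walk:
  assumes "closed_walk_at V E r v (p @ y # ys @ q)"
    and "v \<in> {v0, v1}"
    and "disjnt (set (y # ys)) {v0, v1}"
    and "y \<in> nbhd V E {v0, v1}" "last (y # ys) \<in> nbhd V E {v0, v1}"
  shows "conn_graph_adj V E r v0 v1 y (last (y # ys))"
proof -
  have "{e \<in> ball_edges V E r v. disjnt e {v0, v1}} = {e \<in> ball_edges V E r v. v0 \<notin> e \<and> v1 \<notin> e}"
    by (auto simp: disjnt_def)
  then show ?thesis
    using closed_walk_segment_conn_in[OF assms(1,3)] assms(2,4,5)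
    unfolding conn_graph_adj_def by auto
qed

section \<open>Words in a group\<close>

context group
begin

lemma m_cancel_inv [simp]:
  assumes "x \<in> carrier G" "y \<in> carrier G"
  shows "x \<otimes> (inv x \<otimes> y) = y" "inv x \<otimes> (x \<otimes> y) = y"
  using assms by (simp_all add: m_assoc[symmetric])

lemma eq_inv_of_mult_eq_one:
  "x \<in> carrier G \<Longrightarrow> y \<in> carrier G \<Longrightarrow> x \<otimes> y = \<one> \<Longrightarrow> y = inv x"
  using inv_comm inv_equality by metis

primrec word_prod :: "'a list \<Rightarrow> 'a" where
  "word_prod [] = \<one>"
| "word_prod (a # w) = a \<otimes> word_prod w"

lemma word_prod_closed [simp]: "set w \<subseteq> carrier G \<Longrightarrow> word_prod w \<in> carrier G"
  by (induction w) auto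

lemma word_prod_append:
  "set u \<subseteq> carrier G \<Longrightarrow> set w \<subseteq> carrier G \<Longrightarrow> word_prod (u @ w) = word_prod u \<otimes> word_prod w"
  by (induction u) (auto simp: m_assoc)

primrec word_walk :: "'a \<Rightarrow> 'a list \<Rightarrow> 'a list" where
  "word_walk g [] = [g]"
| "word_walk g (a # w) = g # word_walk (g \<otimes> a) w"

lemma length_word_walk [simp]: "length (word_walk g w) = Suc (length w)"
  by (induction w arbitrary: g) auto

lemma word_walk_not_Nil [simp]: "word_walk g w \<noteq> []"
  by (cases w) auto

lemma hd_word_walk [simp]: "hd (word_walk g w) = g"
  by (cases w) auto

lemma last_word_walk:
  "g \<in> carrier G \<Longrightarrow> set w \<subseteq> carrier G \<Longrightarrow> last (word_walk g w) = g \<otimes> word_prod w"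
  by (induction w arbitrary: g) (auto simp: m_assoc)

text \<open>Reduces the question whether a walk meets one of the two separator vertices to products
  of prefixes of its word.\<close>

lemma set_word_walk:
  assumes "g \<in> carrier G" "set w \<subseteq> carrier G" "v \<in> set (word_walk g w)"
  obtains u z where "w = u @ z" "v = g \<otimes> word_prod u"
proof -
  have "\<exists>u z. w = u @ z \<and> v = g \<otimes> word_prod u"
    using assms
  proof (induction w arbitrary: g)
    case (Cons a w)
    show ?case
    proof (cases "v = g")
      case True
      then show ?thesis
        using Cons.prems by (intro exI[of _ "[]", OF exI[of _ "a # w"]]) simp
    next
      case False
      then have "\<exists>u z. w = u @ z \<and> v = g \<otimes> a \<otimes> word_prod u"
        using Cons.prems by (intro Cons.IH) auto
      then obtain u z where "w = u @ z" "v = g \<otimes> a \<otimes> word_prod u"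
        by blast
      then show ?thesis
        using Cons.prems by (intro exI[of _ "a # u", OF exI[of _ z]]) (simp add: m_assoc)
    qed
  qed simp
  then show thesis
    using that by blast
qed

lemma word_walk_append:
  "word_walk g (u @ c # w) = word_walk g u @ word_walk (last (word_walk g u) \<otimes> c) w"
  by (induction u arbitrary: g) auto

lemma walk_word_walk:
  assumes "S \<subseteq> carrier G" "\<one> \<notin> S" "g \<in> carrier G" "set w \<subseteq> S"
  shows "walk (carrier G) (cayley_adj G S) (word_walk g w)"
  using assms(3,4)
proof (induction w arbitrary: g)
  case Nil
  then show ?case
    by (simp add: walk_def)
next
  case (Cons a w)
  then have a: "a \<in> carrier G" "a \<in> S" "a \<noteq> \<one>"
    using assms by auto
  then have IH: "walk (carrier G) (cayley_adj G S) (word_walk (g \<otimes> a) w)"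
    using Cons by simp
  have adj: "cayley_adj G S g (g \<otimes> a)"
    using a Cons.prems by (auto simp: cayley_adj_def)
  have "cayley_adj G S ((g # word_walk (g \<otimes> a) w) ! i) ((g # word_walk (g \<otimes> a) w) ! Suc i)"
    if "Suc i < length (g # word_walk (g \<otimes> a) w)" for i
    using that IH adj by (cases i) (auto simp: walk_def hd_conv_nth[symmetric])
  then show ?case
    using IH Cons.prems by (simp add: walk_def)
qed

text \<open>The words that trace out cycles in the Cayley graph.\<close>

definition simple_relator :: "'a list \<Rightarrow> bool" where
  "simple_relator w \<longleftrightarrow> w \<noteq> [] \<and> set w \<subseteq> carrier G \<and> word_prod w = \<one> \<and>
     (\<forall>x y z. w = x @ y @ z \<longrightarrow> y \<noteq> [] \<longrightarrow> word_prod y = \<one> \<longrightarrow> x = [] \<and> z = [])"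

lemma simple_relator_proper_infix:
  assumes "simple_relator w" "w = x @ y @ z" "y \<noteq> []" "x \<noteq> [] \<or> z \<noteq> []"
  shows "word_prod y \<noteq> \<one>"
  using assms unfolding simple_relator_def by blast

lemma simple_relator_rotate1:
  assumes "simple_relator (a # w)"
  shows "simple_relator (w @ [a])"
proof -
  have c: "a \<in> carrier G" "set w \<subseteq> carrier G" and e: "a \<otimes> word_prod w = \<one>"
    and s: "\<And>x y z. a # w = x @ y @ z \<Longrightarrow> y \<noteq> [] \<Longrightarrow> word_prod y = \<one> \<Longrightarrow> x = [] \<and> z = []"
    using assms by (auto simp: simple_relator_def)
  have "x = [] \<and> z = []" if w: "w @ [a] = x @ y @ z" and y: "y \<noteq> []" "word_prod y = \<one>" for x y z
  proof (cases z rule: rev_cases)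
    \<comment> \<open>The infix ends with the moved letter \<open>a\<close>. Its complement
      \<open>x\<close> then has trivial product too, since \<open>word_prod w\<close> and
      \<open>word_prod y'\<close> both equal \<open>inv a\<close>; as a non-initial infix of
      \<open>a # w\<close> it has to be empty.\<close>
    case Nil
    then obtain y' where y': "y = y' @ [a]" "w = x @ y'"
      using w y(1) by (cases y rule: rev_cases) auto
    have cxy: "word_prod x \<in> carrier G" "word_prod y' \<in> carrier G"
      using c y' by simp_all
    have "word_prod y' \<otimes> a = \<one>"
      using y(2) y' c by (simp add: word_prod_append)
    then have inv_a: "word_prod y' = inv a"
      using c cxy by (simp add: inv_equality)
    have "word_prod x \<otimes> word_prod y' = inv a"
      using e c y' cxy by (intro eq_inv_of_mult_eq_one) (simp_all add: word_prod_append)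
    then have "word_prod x = \<one>"
      using c cxy by (simp add: inv_a r_cancel_one)
    then show ?thesis
      using s[of "[a]" x y'] y' Nil by auto
  next
    case (snoc z' b)
    then show ?thesis
      using w s[of "a # x" y z'] y by auto
  qed
  moreover have "word_prod w \<otimes> a = \<one>"
    using e c by (metis inv_comm word_prod_closed)
  ultimately show ?thesis
    using c by (auto simp: simple_relator_def word_prod_append)
qed

lemma simple_relator_rotate:
  assumes "simple_relator (x @ y)"
  shows "simple_relator (y @ x)"
  using assms
proof (induction x arbitrary: y)
  case (Cons a x)
  then show ?case
    using simple_relator_rotate1[of a "x @ y"] Cons.IH[of "y @ [a]"] by simp
qed simp

text \<open>A shortest nonempty infix with trivial product works: its own infixes are again infixes
  of \<open>w\<close>, so none of them with trivial product can be shorter.\<close>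

lemma ex_simple_relator_infix:
  assumes "w \<noteq> []" "set w \<subseteq> carrier G" "word_prod w = \<one>"
  obtains x y z where "w = x @ y @ z" "simple_relator y"
proof -
  define P where "P y \<longleftrightarrow> (\<exists>x z. w = x @ y @ z) \<and> y \<noteq> [] \<and> word_prod y = \<one>" for y
  have "P w"
    using assms unfolding P_def by (metis append_Nil append_Nil2)
  then obtain y where y: "P y" "\<And>y'. P y' \<Longrightarrow> length y \<le> length y'"
    using ex_has_least_nat[of P w length] by blast
  then obtain x z where xz: "w = x @ y @ z"
    unfolding P_def by blast
  have "x' = [] \<and> z' = []" if "y = x' @ y' @ z'" "y' \<noteq> []" "word_prod y' = \<one>" for x' y' z'
  proof -
    have "w = (x @ x') @ y' @ (z' @ z)"
      using xz that by simp
    then have "P y'"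
      using that unfolding P_def by blast
    then show ?thesis
      using y(2) that(1) by fastforce
  qed
  then have "simple_relator y"
    using y(1) xz assms unfolding P_def simple_relator_def by auto
  with xz that show thesis
    by blast
qed

text \<open>The signs of the blocks are stored in \<open>ks\<close>, while the letters
  \<open>t\<close> and \<open>inv t\<close> alternate by themselves. Later arguments need only this
  pattern, with \<open>q\<close> equal to 1 or 2 for the commutators of \<open>h\<close> and of its
  square.\<close>

primrec alt_word :: "nat \<Rightarrow> 'a \<Rightarrow> 'a list \<Rightarrow> 'a list" where
  "alt_word q t [] = []"
| "alt_word q t (k # ks) = replicate q k @ t # alt_word q (inv t) ks"

lemma set_alt_word:
  "t \<in> carrier G \<Longrightarrow> set (alt_word q t ks) \<subseteq> set ks \<union> {t, inv t}"
proof (induction ks arbitrary: t)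
  case (Cons k ks)
  then show ?case
    using Cons.IH[of "inv t"] by (auto simp: set_replicate_conv_if)
qed simp

lemma length_alt_word: "length (alt_word q t ks) = Suc q * length ks"
  by (induction ks arbitrary: t) auto

lemma alt_word_append:
  "t \<in> carrier G \<Longrightarrow>
    alt_word q t (ks @ ls) = alt_word q t ks @ alt_word q (if even (length ks) then t else inv t) ls"
  by (induction ks arbitrary: t) auto

text \<open>A relator inside an alternating word may start anywhere, even within a block. What
  follows its starting point is still a partial block, a letter and an alternating word, so only
  this shape has to be treated.\<close>

lemma alt_word_suffix:
  assumes "t \<in> carrier G" "alt_word q t ks = x @ v" "v \<noteq> []"
  shows "\<exists>j k t' ks'. j \<le> q \<and> v = replicate j k @ t' # alt_word q (inv t') ks' \<and>
    k \<in> set ks \<and> set ks' \<subseteq> set ks \<and> t' \<in> {t, inv t}"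
  using assms
proof (induction ks arbitrary: t x)
  case (Cons k ks)
  from Cons.prems(2) have "replicate q k @ t # alt_word q (inv t) ks = x @ v"
    by simp
  \<comment> \<open>The suffix starts in the first block or at \<open>t\<close>, or it starts later
    and the induction hypothesis applies.\<close>
  then consider us where "replicate q k = x @ us" "v = us @ t # alt_word q (inv t) ks"
    | us where "t # alt_word q (inv t) ks = us @ v" "us \<noteq> []"
    unfolding append_eq_append_conv2 by fastforce
  then show ?case
  proof cases
    case 1
    then have "us = replicate (length us) k" "length us \<le> q"
      by (metis append_eq_conv_conj drop_replicate length_replicate)
        (metis 1(1) le_add2 length_append length_replicate)
    with 1 show ?thesis
      by (intro exI[of _ "length us"] exI[of _ k] exI[of _ t] exI[of _ ks]) auto
  next
    case 2
    then obtain us' where "alt_word q (inv t) ks = us' @ v"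
      by (cases us) auto
    from Cons.IH[OF _ this Cons.prems(3)] Cons.prems(1) show ?thesis
      by fastforce
  qed
qed simp

lemma word_prod_replicate: "h \<in> carrier G \<Longrightarrow> word_prod (replicate q h) = h [^] q"
  by (induction q) (simp, metis nat_pow_Suc2 replicate_Suc word_prod.simps(2))

text \<open>The reduced form of the iterated commutator. Its last part \<open>y\<close>, following the leading block,
  is replaced by \<open>inv y \<otimes> inv (h [^] q) \<otimes> y\<close> in each step, so it is convenient to
  have words for both \<open>y\<close> and \<open>inv y\<close>.\<close>

lemma iter_comm_alt_word:
  assumes h: "h \<in> carrier G" and s: "s \<in> carrier G" and "k \<ge> 1"
  shows "\<exists>ks. length ks = 2 ^ k \<and> set ks \<subseteq> {h, inv h} \<and>
    word_prod (alt_word q (inv s) ks) = iter_comm G k (h [^] q) s"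
proof -
  let ?g = "h [^] q"
  \<comment> \<open>With an odd number of blocks this word runs from \<open>inv s\<close> to
    \<open>s\<close>. A block and a further word of this kind can then be appended, as in
    \<open>join\<close>, and the letters still alternate.\<close>
  let ?Y = "\<lambda>cs. word_prod (inv s # alt_word q s cs)"
  let ?ok = "\<lambda>k cs. length cs = 2 ^ k - 1 \<and> set cs \<subseteq> {h, inv h}"
  have g: "?g \<in> carrier G"
    using h by simp
  have cl: "set (alt_word q t cs) \<subseteq> carrier G" if "set cs \<subseteq> {h, inv h}" "t \<in> carrier G" for t cs
    using set_alt_word[of t q cs] that h by auto
  have Y: "?Y cs \<in> carrier G" if "set cs \<subseteq> {h, inv h}" for cs
    using that s cl by simp
  have join: "?Y (cs @ c # ds) = ?Y cs \<otimes> c [^] q \<otimes> ?Y ds"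
    if "odd (length cs)" "set cs \<subseteq> {h, inv h}" "c \<in> {h, inv h}" "set ds \<subseteq> {h, inv h}" for cs c ds
  proof -
    have c: "c \<in> carrier G"
      using that h by auto
    have "alt_word q s (cs @ c # ds) = alt_word q s cs @ replicate q c @ inv s # alt_word q s ds"
      using that s by (simp add: alt_word_append)
    moreover have "set (replicate q c) \<subseteq> carrier G"
      using c by auto
    ultimately show ?thesis
      using that s c cl by (simp add: word_prod_append word_prod_replicate m_assoc)
  qed
  have "\<exists>cs ds. ?ok k cs \<and> ?ok k ds \<and> iter_comm G k ?g s = ?g \<otimes> ?Y cs \<and> ?Y ds = inv (?Y cs)"
    using \<open>k \<ge> 1\<close>
  proof (induction k rule: dec_induct)
    case base
    have "set (replicate q h) \<subseteq> carrier G" "set (replicate q (inv h)) \<subseteq> carrier G"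
      using h by auto
    then show ?case
      using h s g
      by (intro exI[of _ "[inv h]", OF exI[of _ "[h]"]])
        (simp add: word_prod_append word_prod_replicate m_assoc nat_pow_inv inv_mult_group)
  next
    case (step k)
    then obtain cs ds where cs: "?ok k cs" "?ok k ds"
      "iter_comm G k ?g s = ?g \<otimes> ?Y cs" "?Y ds = inv (?Y cs)"
      by blast
    \<comment> \<open>Here \<open>k\<close> is positive, so \<open>2 ^ k - 1\<close> is odd, as
      \<open>join\<close> demands.\<close>
    have "even (2 ^ k :: nat)" "(2 ^ k :: nat) \<ge> 1"
      using step.hyps by simp_all
    moreover have "length cs = 2 ^ k - 1" "length ds = 2 ^ k - 1"
      using cs by simp_all
    ultimately have odd: "odd (length ds)" and len: "length ds + length cs + 1 = 2 ^ Suc k - 1"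
      unfolding power_Suc by (simp add: even_diff_nat, linarith)
    have y: "?Y cs \<in> carrier G"
      using cs Y by blast
    have 1: "?Y (ds @ inv h # cs) = inv (?Y cs) \<otimes> inv ?g \<otimes> ?Y cs"
      using join[of ds "inv h" cs] odd cs h by (simp add: nat_pow_inv)
    have 2: "?Y (ds @ h # cs) = inv (?Y cs) \<otimes> ?g \<otimes> ?Y cs"
      using join[of ds h cs] odd cs h by simp
    \<comment> \<open>Changing the sign of the middle block inverts the conjugate, so the inverse
      again has a word of the same form.\<close>
    have "?Y (ds @ h # cs) = inv (?Y (ds @ inv h # cs))"
      using y g unfolding 1 2 by (simp add: inv_mult_group m_assoc del: word_prod.simps)
    moreover have "iter_comm G (Suc k) ?g s = ?g \<otimes> ?Y (ds @ inv h # cs)"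
      using y g cs(3) unfolding 1 by (simp add: inv_mult_group m_assoc del: word_prod.simps)
    ultimately show ?case
      using cs len
      by (intro exI[of _ "ds @ inv h # cs", OF exI[of _ "ds @ h # cs"]])
        (simp del: word_prod.simps iter_comm.simps)
  qed
  then obtain cs where cs: "?ok k cs" "iter_comm G k ?g s = ?g \<otimes> ?Y cs"
    by blast
  have "word_prod (alt_word q (inv s) (h # cs)) = ?g \<otimes> ?Y cs"
  proof -
    have "set (replicate q h) \<subseteq> carrier G"
      using h by auto
    then show ?thesis
      using cs h s cl by (simp add: word_prod_append word_prod_replicate)
  qed
  then show ?thesis
    using cs by (intro exI[of _ "h # cs"]) simp
qed

text \<open>The cases are the prefixes of each length up to four and the longer ones. From five
  letters on, a block between \<open>t\<close> and \<open>inv t\<close> and one between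
  \<open>inv t\<close> and \<open>t\<close> are both visible.\<close>

lemma alt_word_1_prefix:
  assumes "t \<in> carrier G" "w @ z = t # alt_word 1 (inv t) ks"
  obtains "w = []"
  | "w = [t]"
  | k where "k \<in> set ks" "w = [t, k]"
  | k where "k \<in> set ks" "w = [t, k, inv t]"
  | k k' where "k \<in> set ks" "k' \<in> set ks" "w = [t, k, inv t, k']"
  | k k' u where "k \<in> set ks" "k' \<in> set ks" "w = [t, k, inv t, k', t] @ u"
proof (cases ks)
  case Nil
  then show thesis
    using assms that(1,2) by (auto simp: append_eq_Cons_conv)
next
  case (Cons k1 ks1)
  then show thesis
  proof (cases ks1)
    case Nil
    then show thesis
      using assms that(1-4) Cons by (auto simp: append_eq_Cons_conv)
  next
    case (Cons k2 ks2)
    then show thesis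
      using assms that \<open>ks = k1 # ks1\<close> by (auto simp: append_eq_Cons_conv)
  qed
qed

text \<open>The prefixes \<open>[t]\<close> and \<open>[t, k, k, inv t]\<close> are cases of their
  own because \<open>ks\<close> may have no further entry to name the next block.\<close>

lemma alt_word_2_prefix:
  assumes "t \<in> carrier G" "w @ z = t # alt_word 2 (inv t) ks"
  obtains "w = []"
  | i k where "k \<in> set ks" "w = t # replicate i k"
  | "w = [t]"
  | i k k' where "k \<in> set ks" "k' \<in> set ks" "i \<le> 2" "w = [t, k, k, inv t] @ replicate i k'"
  | k where "k \<in> set ks" "w = [t, k, k, inv t]"
  | k k' u where "k \<in> set ks" "k' \<in> set ks" "w = [t, k, k, inv t, k', k', t] @ u"
proof (cases ks)
  case Nil
  then show thesis
    using assms that(1,3) by (auto simp: append_eq_Cons_conv)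
next
  case (Cons k1 ks1)
  then show thesis
  proof (cases ks1)
    case Nil
    then show thesis
      using assms that(1,3,5) that(2)[of k1 1] that(2)[of k1 2] Cons
      by (auto simp: append_eq_Cons_conv numeral_2_eq_2)
  next
    case (Cons k2 ks2)
    then show thesis
      using assms that(1,3,5,6) that(2)[of k1 1] that(2)[of k1 2] that(4)[of k1 k2 1] that(4)[of k1 k2 2]
        \<open>ks = k1 # ks1\<close>
      by (auto simp: append_eq_Cons_conv numeral_2_eq_2)
  qed
qed

end

section \<open>Links at an edge of a Cayley graph\<close>

text \<open>The bound 8 is what \<open>2 ^ (n + 2) \<le> r\<close> gives for positive
  \<open>n\<close>, and it is the length of the longest cycles written out below.\<close>

locale cayley_edge = group G for G (structure) +
  fixes S :: "'a set" and h :: 'a and r :: nat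
  assumes S_carrier: "S \<subseteq> carrier G"
    and S_inv: "s \<in> S \<Longrightarrow> inv s \<in> S"
    and one_notin_S: "\<one> \<notin> S"
    and h_S: "h \<in> S"
    and h_not_involution: "h \<otimes> h \<noteq> \<one>"
    and r_ge: "8 \<le> r"
begin

abbreviation linked :: "'a \<Rightarrow> 'a \<Rightarrow> bool" (infix "\<leadsto>" 50) where
  "a \<leadsto> b \<equiv> (conn_graph_adj (carrier G) (cayley_adj G S) r \<one> h)\<^sup>*\<^sup>* a b"

section \<open>Links produced by cycles through the edge between \<open>\<one>\<close> and
  \<open>h\<close>\<close>

lemma linked_sym: "a \<leadsto> b \<Longrightarrow> b \<leadsto> a"
  using symp_rtranclp[OF symp_conn_graph_adj] by (rule sympD)

lemma linked_trans: "a \<leadsto> b \<Longrightarrow> b \<leadsto> c \<Longrightarrow> a \<leadsto> c"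
  by (rule rtranclp_trans)

lemma h_carrier [simp]: "h \<in> carrier G"
  using h_S S_carrier by blast

lemma inv_h_S: "inv h \<in> S"
  using h_S by (rule S_inv)

lemma h_neq [simp]:
  "h \<noteq> \<one>" "\<one> \<noteq> h" "inv h \<noteq> \<one>" "\<one> \<noteq> inv h" "inv h \<noteq> h" "h \<otimes> h \<noteq> h"
proof -
  show "h \<noteq> \<one>" "inv h \<noteq> \<one>"
    using h_S inv_h_S one_notin_S by auto
  then show "\<one> \<noteq> h" "\<one> \<noteq> inv h"
    by metis+
  show "h \<otimes> h \<noteq> h"
    using \<open>h \<noteq> \<one>\<close> by simp
  show "inv h \<noteq> h"
    using h_not_involution r_inv[OF h_carrier] by metis
qed

text \<open>The word \<open>b # u @ [c]\<close> leads from \<open>x\<close> to \<open>y\<close>, and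
  at most one step along the edge between \<open>\<one>\<close> and \<open>h\<close> returns to
  \<open>x\<close>. The part of this closed walk traced by \<open>u\<close> avoids both vertices,
  and its ends are adjacent to \<open>x\<close> and \<open>y\<close>. The 3 in \<open>len\<close>
  counts \<open>b\<close>, \<open>c\<close> and the return step.\<close>

lemma linked_walk:
  assumes x: "x \<in> {\<one>, h}" and y: "y \<in> {\<one>, h}" and b: "b \<in> S" and c: "c \<in> S" and u: "set u \<subseteq> S"
    and closes: "x \<otimes> b \<otimes> word_prod u \<otimes> c = y" and len: "length u + 3 \<le> r"
    and avoid: "\<And>v. v \<in> set (word_walk (x \<otimes> b) u) \<Longrightarrow> v \<noteq> \<one> \<and> v \<noteq> h"
  shows "x \<otimes> b \<leadsto> x \<otimes> b \<otimes> word_prod u"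
proof -
  let ?V = "carrier G" and ?E = "cayley_adj G S"
  have car: "x \<in> carrier G" "y \<in> carrier G" "b \<in> carrier G" "c \<in> carrier G" "set u \<subseteq> carrier G"
    using x y b c u S_carrier by auto
  obtain d where d: "set d \<subseteq> S" "length d \<le> 1" "y \<otimes> word_prod d = x"
  proof -
    consider "x = y" | "x = h" "y = \<one>" | "x = \<one>" "y = h"
      using x y by auto
    then show thesis
      using that[of "[]"] that[of "[h]"] that[of "[inv h]"] car h_S inv_h_S by cases auto
  qed
  let ?l = "x \<otimes> b \<otimes> word_prod u"
  let ?q = "word_walk y d"
  have last: "last (word_walk (x \<otimes> b) u) = ?l"
    using car by (simp add: last_word_walk)
  have "word_walk x (b # u @ c # d) = [x] @ word_walk (x \<otimes> b) u @ ?q"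
    using last closes by (simp add: word_walk_append)
  moreover obtain ys where ys: "word_walk (x \<otimes> b) u = (x \<otimes> b) # ys"
    by (cases u) auto
  ultimately have split: "word_walk x (b # u @ c # d) = [x] @ (x \<otimes> b) # ys @ ?q"
    by simp
  have "walk ?V ?E (word_walk x (b # u @ c # d))"
    using b c u d car by (intro walk_word_walk S_carrier one_notin_S) auto
  moreover have "last (word_walk x (b # u @ c # d)) = x"
    using d car S_carrier unfolding split by (simp add: last_word_walk)
  moreover have "length (word_walk x (b # u @ c # d)) \<le> Suc r"
    using d len by simp
  ultimately have cw: "closed_walk_at ?V ?E r x ([x] @ (x \<otimes> b) # ys @ ?q)"
    unfolding split by (simp add: closed_walk_at_def)
  have av: "v \<noteq> \<one> \<and> v \<noteq> h" if "v \<in> set ((x \<otimes> b) # ys)" for v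
    using avoid that ys by simp
  have l: "last ((x \<otimes> b) # ys) = ?l"
    using last ys by simp
  then have lav: "?l \<noteq> \<one> \<and> ?l \<noteq> h"
    using av[of ?l] by (metis last_in_set list.distinct(1))
  have "?E x (x \<otimes> b)"
    using av[of "x \<otimes> b"] x b car by (auto simp: cayley_adj_def)
  then have 1: "x \<otimes> b \<in> nbhd ?V ?E {\<one>, h}"
    using av[of "x \<otimes> b"] x car by (auto simp: nbhd_def)
  have "?E y ?l"
    using lav y c car closes by (auto simp: cayley_adj_def)
  then have 2: "?l \<in> nbhd ?V ?E {\<one>, h}"
    using lav y car by (auto simp: nbhd_def)
  have "conn_graph_adj ?V ?E r \<one> h (x \<otimes> b) (last ((x \<otimes> b) # ys))"
  proof (rule conn_graph_adj_closed_walk[OF cw])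
    show "x \<in> {\<one>, h}" by (rule x)
    show "disjnt (set ((x \<otimes> b) # ys)) {\<one>, h}"
      using av by (auto simp: disjnt_def)
    show "x \<otimes> b \<in> nbhd ?V ?E {\<one>, h}" by (rule 1)
    show "last ((x \<otimes> b) # ys) \<in> nbhd ?V ?E {\<one>, h}"
      unfolding l by (rule 2)
  qed
  then show ?thesis
    unfolding l by (rule r_into_rtranclp)
qed

text \<open>The relator is read as the cycle through \<open>inv a\<close>, \<open>\<one>\<close>,
  \<open>h\<close>, \<open>h \<otimes> b\<close> and so on. Meeting \<open>\<one>\<close> or
  \<open>h\<close> again would make a proper infix trivial.\<close>

lemma linked_window:
  assumes w: "simple_relator (a # h # b # u)" and S: "a \<in> S" "b \<in> S" "set u \<subseteq> S"
    and len: "length u + 3 \<le> r"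
  shows "h \<otimes> b \<leadsto> inv a"
proof -
  have car: "a \<in> carrier G" "b \<in> carrier G" "set u \<subseteq> carrier G"
    using S S_carrier by auto
  have "a \<otimes> (h \<otimes> b \<otimes> word_prod u) = \<one>"
    using w car by (simp add: simple_relator_def m_assoc)
  then have e: "h \<otimes> b \<otimes> word_prod u = inv a"
    using car by (intro eq_inv_of_mult_eq_one) simp_all
  have "h \<otimes> b \<leadsto> h \<otimes> b \<otimes> word_prod u"
  proof (rule linked_walk[where y = \<one> and c = a])
    show "h \<otimes> b \<otimes> word_prod u \<otimes> a = \<one>"
      using e car by simp
    fix v
    assume "v \<in> set (word_walk (h \<otimes> b) u)"
    then obtain u1 u2 where u: "u = u1 @ u2" "v = h \<otimes> b \<otimes> word_prod u1"
      using set_word_walk[of "h \<otimes> b" u v] car by auto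
    have car1: "set u1 \<subseteq> carrier G"
      using u car by simp
    have "v \<noteq> \<one>"
      using simple_relator_proper_infix[OF w, of "[a]" "h # b # u1" u2] u car car1
      by (simp add: m_assoc)
    moreover have "b \<otimes> word_prod u1 \<noteq> \<one>"
      using simple_relator_proper_infix[OF w, of "[a, h]" "b # u1" u2] u by simp
    then have "v \<noteq> h"
      using u car car1 by (simp add: m_assoc)
    ultimately show "v \<noteq> \<one> \<and> v \<noteq> h" ..
  qed (use S len in auto)
  then show ?thesis
    by (simp only: e)
qed

text \<open>Here the cycle runs along the edge from \<open>h\<close> to \<open>\<one>\<close>: it
  reaches \<open>h\<close> from \<open>h \<otimes> inv a\<close> and leaves \<open>\<one>\<close>
  towards \<open>b\<close>.\<close>

lemma linked_window_inv:
  assumes w: "simple_relator (a # inv h # b # u)" and S: "a \<in> S" "b \<in> S" "set u \<subseteq> S"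
    and len: "length u + 3 \<le> r"
  shows "b \<leadsto> h \<otimes> inv a"
proof -
  have car: "a \<in> carrier G" "b \<in> carrier G" "set u \<subseteq> carrier G"
    using S S_carrier by auto
  have "a \<otimes> (inv h \<otimes> (b \<otimes> word_prod u)) = \<one>"
    using w car by (simp add: simple_relator_def m_assoc)
  then have "inv h \<otimes> (b \<otimes> word_prod u) = inv a"
    using car by (intro eq_inv_of_mult_eq_one) simp_all
  then have e: "b \<otimes> word_prod u = h \<otimes> inv a"
    using car by (metis h_carrier m_cancel_inv(1) m_closed word_prod_closed)
  have "\<one> \<otimes> b \<leadsto> \<one> \<otimes> b \<otimes> word_prod u"
  proof (rule linked_walk[where y = h and c = a])
    show "\<one> \<otimes> b \<otimes> word_prod u \<otimes> a = h"
      using e car by (simp add: m_assoc)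
    fix v
    assume "v \<in> set (word_walk (\<one> \<otimes> b) u)"
    then obtain u1 u2 where u: "u = u1 @ u2" "v = b \<otimes> word_prod u1"
      using set_word_walk[of b u v] car by auto
    have car1: "set u1 \<subseteq> carrier G"
      using u car by simp
    have "v \<noteq> \<one>"
      using simple_relator_proper_infix[OF w, of "[a, inv h]" "b # u1" u2] u by simp
    moreover have "inv h \<otimes> (b \<otimes> word_prod u1) \<noteq> \<one>"
      using simple_relator_proper_infix[OF w, of "[a]" "inv h # b # u1" u2] u by simp
    then have "v \<noteq> h"
      using u car car1 by auto
    ultimately show "v \<noteq> \<one> \<and> v \<noteq> h" ..
  qed (use S len in auto)
  then show ?thesis
    using car e by simp
qed

text \<open>The neighbours \<open>inv h\<close> and \<open>h \<otimes> h\<close> do not depend on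
  \<open>t\<close> and serve as a common hub: the three links put \<open>t\<close> and
  \<open>h \<otimes> t\<close>, the neighbours contributed by \<open>t\<close>, into one component
  with them.\<close>

definition amalgamated :: "'a \<Rightarrow> bool" where
  "amalgamated t \<longleftrightarrow> t \<leadsto> h \<otimes> t \<and> t \<leadsto> h \<otimes> h \<and> inv h \<leadsto> h \<otimes> t"

lemma amalgamatedD:
  assumes "amalgamated t"
  shows "inv h \<leadsto> t" "inv h \<leadsto> h \<otimes> t" "inv h \<leadsto> h \<otimes> h"
proof -
  have l: "t \<leadsto> h \<otimes> t" "t \<leadsto> h \<otimes> h" "inv h \<leadsto> h \<otimes> t"
    using assms unfolding amalgamated_def by blast+
  show "inv h \<leadsto> h \<otimes> t"
    by (rule l)
  show "inv h \<leadsto> t"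
    by (rule linked_trans[OF l(3) linked_sym[OF l(1)]])
  then show "inv h \<leadsto> h \<otimes> h"
    using l(2) by (rule linked_trans)
qed

text \<open>Both signs of \<open>k\<close> give the same link, one by \<open>linked_window\<close>
  and the other by \<open>linked_window_inv\<close>, so signs of blocks do not matter.\<close>

lemma linked_window_block:
  assumes "simple_relator (t # k # inv t # u)" "k \<in> {h, inv h}" "t \<in> S" "set u \<subseteq> S"
    and "length u + 3 \<le> r"
  shows "inv t \<leadsto> h \<otimes> inv t"
  using assms linked_window[of t "inv t" u] linked_window_inv[of t "inv t" u] S_inv linked_sym by auto

text \<open>For \<open>k = h\<close> the two relators give the two links in the order stated; for
  \<open>k = inv h\<close> they exchange roles.\<close>

lemma linked_window_block_2:
  assumes "simple_relator (t # k # k # u)" "simple_relator (k # k # inv t # u')"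
    and "k \<in> {h, inv h}" "t \<in> S" "set u \<subseteq> S" "set u' \<subseteq> S"
    and "length u + 3 \<le> r" "length u' + 3 \<le> r"
  shows "inv t \<leadsto> h \<otimes> h \<and> inv h \<leadsto> h \<otimes> inv t"
proof (cases "k = h")
  case True
  then show ?thesis
    using assms linked_window[of t h u] linked_window[of h "inv t" u'] S_inv h_S linked_sym by auto
next
  case False
  then have "k = inv h"
    using assms by auto
  then show ?thesis
    using assms linked_window_inv[of t "inv h" u] linked_window_inv[of "inv h" "inv t" u']
      S_inv h_S linked_sym by auto
qed

text \<open>The links come from the square on \<open>\<one>\<close>, \<open>s\<close>,
  \<open>h \<otimes> s\<close>, \<open>h\<close> and its translates by \<open>inv h\<close> and
  \<open>h\<close>. The excluded values of \<open>s\<close> are those for which a translate would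
  meet \<open>\<one>\<close> or \<open>h\<close> where it must not.\<close>

lemma amalgamated_commuting:
  assumes s: "s \<in> S" and comm: "s \<otimes> h = h \<otimes> s"
    and ne: "s \<notin> {h, inv h, h \<otimes> h, inv (h \<otimes> h)}"
  shows "amalgamated s"
proof -
  have car: "s \<in> carrier G" and s1: "s \<noteq> \<one>"
    using s S_carrier one_notin_S by auto
  have "h \<otimes> (s \<otimes> inv h) = s \<otimes> h \<otimes> inv h"
    unfolding comm using car by (simp add: m_assoc)
  then have comm': "inv h \<otimes> (s \<otimes> h) = s" "h \<otimes> (s \<otimes> inv h) = s"
    using car by (simp_all add: comm, simp add: comm[symmetric] m_assoc)
  have hs: "h \<otimes> s \<noteq> \<one>" "inv h \<otimes> s \<noteq> \<one>" "s \<noteq> h"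
    using ne car eq_inv_of_mult_eq_one[of h s] eq_inv_of_mult_eq_one[of "inv h" s] by auto
  have hhs: "h \<otimes> (h \<otimes> s) \<noteq> \<one>"
    using ne car eq_inv_of_mult_eq_one[of "h \<otimes> h" s] by (auto simp: m_assoc)
  have hhs': "h \<otimes> (h \<otimes> s) \<noteq> h"
    using hs car by simp
  have ihs: "inv h \<otimes> s \<noteq> h"
  proof
    assume "inv h \<otimes> s = h"
    then have "s = h \<otimes> h"
      using m_cancel_inv(1)[of h s] car by simp
    then show False
      using ne by simp
  qed
  have 1: "\<one> \<otimes> s \<leadsto> \<one> \<otimes> s \<otimes> word_prod [h]"
    by (rule linked_walk[where y = h and c = "inv s"])
      (use s S_inv[OF s] inv_h_S h_S r_ge car comm hs s1 in \<open>auto simp: m_assoc\<close>)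
  have 2: "\<one> \<otimes> inv h \<leadsto> \<one> \<otimes> inv h \<otimes> word_prod [s, h]"
    by (rule linked_walk[where y = \<one> and c = "inv s"])
      (use s S_inv[OF s] inv_h_S h_S r_ge car comm' hs hhs hhs' ihs s1 in \<open>auto simp: m_assoc\<close>)
  have 3: "h \<otimes> h \<leadsto> h \<otimes> h \<otimes> word_prod [s, inv h]"
    by (rule linked_walk[where y = h and c = "inv s"])
      (use s S_inv[OF s] inv_h_S h_S r_ge car comm' hs hhs hhs' ihs s1 h_not_involution in \<open>auto simp: m_assoc\<close>)
  have l: "s \<leadsto> h \<otimes> s" "inv h \<leadsto> s" "h \<otimes> h \<leadsto> h \<otimes> s"
    using 1 2 3 car comm comm' by (simp_all add: m_assoc)
  show ?thesis
    unfolding amalgamated_def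
    using l(1) linked_trans[OF l(1) linked_sym[OF l(3)]] linked_trans[OF l(2,1)] by blast
qed

section \<open>The centralizer of \<open>h\<close> and relations that conjugate \<open>h\<close> to
  a square\<close>

definition commuting :: "'a set" where
  "commuting = {x \<in> carrier G. x \<otimes> h = h \<otimes> x}"

lemma commuting_basic [simp]: "\<one> \<in> commuting" "h \<in> commuting" "inv h \<in> commuting"
  by (simp_all add: commuting_def)

lemma commuting_mult_iff:
  assumes x: "x \<in> commuting" and y: "y \<in> carrier G"
  shows "x \<otimes> y \<in> commuting \<longleftrightarrow> y \<in> commuting" "y \<otimes> x \<in> commuting \<longleftrightarrow> y \<in> commuting"
proof -
  have xc: "x \<in> carrier G" and xh: "x \<otimes> h = h \<otimes> x"
    using x by (auto simp: commuting_def)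
  have "h \<otimes> (x \<otimes> y) = x \<otimes> (h \<otimes> y)"
    using xc y xh by (simp add: m_assoc[symmetric])
  then show "x \<otimes> y \<in> commuting \<longleftrightarrow> y \<in> commuting"
    using xc y by (simp add: commuting_def m_assoc)
  have "y \<otimes> x \<otimes> h = y \<otimes> h \<otimes> x" "h \<otimes> (y \<otimes> x) = h \<otimes> y \<otimes> x"
    using xc y xh by (simp_all add: m_assoc)
  then show "y \<otimes> x \<in> commuting \<longleftrightarrow> y \<in> commuting"
    using xc y by (simp add: commuting_def)
qed

lemma commuting_inv:
  assumes "x \<in> commuting"
  shows "inv x \<in> commuting"
proof -
  have "x \<in> carrier G"
    using assms by (simp add: commuting_def)
  then show ?thesis
    using commuting_mult_iff(1)[OF assms, of "inv x"] by simp
qed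

lemma commuting_inv_iff: "x \<in> carrier G \<Longrightarrow> inv x \<in> commuting \<longleftrightarrow> x \<in> commuting"
  using commuting_inv commuting_inv[of "inv x"] by auto

text \<open>Multiplication by \<open>h\<close> or \<open>inv h\<close> preserves membership in the
  centralizer and its complement, so this test settles whole stretches of a walk at once.\<close>

lemma not_commuting_neq: "v \<notin> commuting \<Longrightarrow> v \<noteq> \<one> \<and> v \<noteq> h"
  by auto

lemma word_prod_commuting: "set w \<subseteq> {h, inv h} \<Longrightarrow> word_prod w \<in> commuting"
proof (induction w)
  case (Cons a w)
  then have "set w \<subseteq> carrier G" "a \<in> commuting" "word_prod w \<in> commuting"
    by auto
  then show ?case
    by (simp add: commuting_mult_iff)
qed simp

text \<open>Rules out short relators: a letter that is the only one besides \<open>h\<close> and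
  \<open>inv h\<close> would itself be a power of \<open>h\<close>.\<close>

lemma relator_one_letter_commuting:
  assumes "set a \<subseteq> {h, inv h}" "set b \<subseteq> {h, inv h}" "t \<in> carrier G"
    and "word_prod (a @ t # b) = \<one>"
  shows "t \<in> commuting"
proof -
  have "set a \<subseteq> carrier G" "set b \<subseteq> carrier G"
    using assms by auto
  then have "word_prod a \<otimes> (t \<otimes> word_prod b) \<in> commuting"
    using assms by (simp add: word_prod_append)
  then show ?thesis
    using assms word_prod_commuting[of a] word_prod_commuting[of b] \<open>set b \<subseteq> carrier G\<close>
    by (simp add: commuting_mult_iff)
qed

text \<open>The relation \<open>t \<otimes> h \<otimes> inv t = c \<otimes> c\<close> gives a 5-cycle and, after squaring, an 8-cycle. All vertices
  of these that have to avoid \<open>\<one>\<close> and \<open>h\<close> do so because they are powers of \<open>h\<close> other than these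
  or do not commute with \<open>h\<close>.\<close>

lemma amalgamated_conj_square:
  assumes t: "t \<in> S" "t \<notin> commuting" and c: "c \<in> {h, inv h}" and tc: "t \<otimes> h \<otimes> inv t = c \<otimes> c"
  shows "amalgamated t" "amalgamated (inv t)"
proof -
  define d where "d = inv c"
  have car: "t \<in> carrier G" "c \<in> carrier G" "d \<in> carrier G"
    using t c S_carrier by (auto simp: d_def)
  have dS: "d \<in> S" "d \<in> commuting"
    using c inv_h_S h_S by (auto simp: d_def)
  have th: "t \<otimes> h = c \<otimes> (c \<otimes> t)"
  proof -
    have "t \<otimes> h = t \<otimes> h \<otimes> inv t \<otimes> t"
      using car by (simp add: m_assoc)
    then show ?thesis
      unfolding tc using car by (simp add: m_assoc)
  qed
  have "h = inv t \<otimes> (c \<otimes> (c \<otimes> t))"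
    unfolding th[symmetric] using car by simp
  then have ht: "h \<otimes> inv t = inv t \<otimes> (c \<otimes> c)"
    using car by (simp add: m_assoc)
  have A: "h \<otimes> (inv t \<otimes> (d \<otimes> d)) = inv t"
    using ht car by (simp add: m_assoc[symmetric] d_def) (simp add: m_assoc)
  have A': "h \<otimes> (inv t \<otimes> (d \<otimes> (d \<otimes> x))) = inv t \<otimes> x" if "x \<in> carrier G" for x
  proof -
    have "h \<otimes> (inv t \<otimes> (d \<otimes> (d \<otimes> x))) = h \<otimes> (inv t \<otimes> (d \<otimes> d)) \<otimes> x"
      using car that by (simp add: m_assoc)
    then show ?thesis
      unfolding A .
  qed
  have B: "h \<otimes> (t \<otimes> d) = inv h \<otimes> t"
  proof (cases "c = h")
    case True
    have "h \<otimes> (t \<otimes> d) = inv h \<otimes> (t \<otimes> h \<otimes> d)"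
      unfolding th using car True by (simp add: m_assoc)
    then show ?thesis
      using car True by (simp add: m_assoc d_def)
  next
    case False
    then have "d = h" "c = inv h"
      using c by (auto simp: d_def)
    then show ?thesis
      using th car by simp
  qed
  have nc: "t \<notin> commuting" "inv t \<notin> commuting"
    using t car by (simp_all add: commuting_inv_iff)
  note simps = m_assoc commuting_mult_iff nc dS
  have av: "v \<noteq> \<one> \<and> v \<noteq> h" if "v \<notin> commuting \<or> v = h \<otimes> h \<or> v = inv h" for v
    using that not_commuting_neq h_not_involution by auto
  \<comment> \<open>Links \<open>1\<close>, \<open>2\<close> and \<open>3\<close> come from the
    5-cycle, each of whose three edges labelled \<open>h\<close> or \<open>inv h\<close> is placed
    in turn on the edge between \<open>\<one>\<close> and \<open>h\<close>.\<close>
  have 1: "h \<otimes> inv t \<leadsto> h \<otimes> inv t \<otimes> word_prod [d, d]"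
  proof (rule linked_walk[where y = \<one> and c = t])
    fix v assume "v \<in> set (word_walk (h \<otimes> inv t) [d, d])"
    then show "v \<noteq> \<one> \<and> v \<noteq> h"
      using car by (intro av) (auto simp: simps)
  qed (use t S_inv[OF t(1)] inv_h_S h_S r_ge car A dS in \<open>auto simp: m_assoc\<close>)
  have 2: "h \<otimes> h \<leadsto> h \<otimes> h \<otimes> word_prod [t, d]"
  proof (rule linked_walk[where y = \<one> and c = "inv t"])
    fix v assume "v \<in> set (word_walk (h \<otimes> h) [t, d])"
    then show "v \<noteq> \<one> \<and> v \<noteq> h"
      using car by (intro av) (auto simp: simps)
  qed (use t S_inv[OF t(1)] inv_h_S h_S r_ge car B dS in \<open>auto simp: m_assoc\<close>)
  have 3: "h \<otimes> t \<leadsto> h \<otimes> t \<otimes> word_prod [d, inv t]"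
  proof (rule linked_walk[where y = \<one> and c = h])
    have "h \<otimes> t \<otimes> d \<otimes> inv t = inv h"
      using B car by (simp add: m_assoc[symmetric]) (simp add: m_assoc)
    moreover fix v assume "v \<in> set (word_walk (h \<otimes> t) [d, inv t])"
    ultimately show "v \<noteq> \<one> \<and> v \<noteq> h"
      using car by (intro av) (auto simp: simps)
  next
    show "h \<otimes> t \<otimes> word_prod [d, inv t] \<otimes> h = \<one>"
      using B car by (simp add: m_assoc[symmetric]) (simp add: m_assoc)
  qed (use t S_inv[OF t(1)] inv_h_S h_S r_ge dS in auto)
  \<comment> \<open>Links \<open>4\<close> and \<open>5\<close> come from the 8-cycle of the squared
    relation, placed at either edge of its block of two letters.\<close>
  have 4: "h \<otimes> h \<leadsto> h \<otimes> h \<otimes> word_prod [inv t, d, d, d, d]"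
  proof (rule linked_walk[where y = \<one> and c = t])
    fix v assume "v \<in> set (word_walk (h \<otimes> h) [inv t, d, d, d, d])"
    then show "v \<noteq> \<one> \<and> v \<noteq> h"
      using car by (intro av) (auto simp: simps)
  qed (use t S_inv[OF t(1)] inv_h_S h_S r_ge car A A' dS in \<open>auto simp: m_assoc\<close>)
  have C: "inv t \<otimes> (d \<otimes> (d \<otimes> t)) = inv h"
  proof -
    have "h \<otimes> (inv t \<otimes> (d \<otimes> (d \<otimes> t))) = \<one>"
      using A' car by simp
    then show ?thesis
      using car by (intro eq_inv_of_mult_eq_one) simp_all
  qed
  have 5: "h \<otimes> inv t \<leadsto> h \<otimes> inv t \<otimes> word_prod [d, d, d, d, t]"
  proof (rule linked_walk[where y = \<one> and c = h])
    fix v assume "v \<in> set (word_walk (h \<otimes> inv t) [d, d, d, d, t])"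
    then show "v \<noteq> \<one> \<and> v \<noteq> h"
      using car A' C by (intro av) (auto simp: simps)
  qed (use t S_inv[OF t(1)] inv_h_S h_S r_ge car A' C dS in \<open>auto simp: m_assoc\<close>)
  have E: "h \<otimes> (t \<otimes> (d \<otimes> inv t)) = inv h"
    using B car by (simp add: m_assoc[symmetric]) (simp add: m_assoc)
  have l: "h \<otimes> inv t \<leadsto> inv t" "h \<otimes> h \<leadsto> t" "h \<otimes> t \<leadsto> inv h" "h \<otimes> h \<leadsto> inv t" "h \<otimes> inv t \<leadsto> inv h"
    using 1 2 3 4 5 car A A' B C E by (simp_all add: m_assoc)
  \<comment> \<open>The chain passes through \<open>t\<close>, \<open>h \<otimes> h\<close>,
    \<open>inv t\<close>, \<open>h \<otimes> inv t\<close>, \<open>inv h\<close> and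
    \<open>h \<otimes> t\<close>.\<close>
  have "t \<leadsto> inv t"
    by (rule linked_trans[OF linked_sym[OF l(2)] l(4)])
  also have "inv t \<leadsto> inv h"
    by (rule linked_trans[OF linked_sym[OF l(1)] l(5)])
  also have "inv h \<leadsto> h \<otimes> t"
    by (rule linked_sym[OF l(3)])
  finally show "amalgamated t" "amalgamated (inv t)"
    unfolding amalgamated_def using l linked_sym by blast+
qed

text \<open>Opposite factors on the right would force \<open>k = \<one>\<close>, and inverting the
  relation turns \<open>k = inv h\<close> into \<open>h\<close>. What remains is
  \<open>amalgamated_conj_square\<close>.\<close>

lemma conj_square_cases:
  assumes t: "t \<in> S" "t \<notin> commuting" and k: "k \<in> {h, inv h}" "l \<in> {h, inv h}" "m \<in> {h, inv h}"
    and e: "t \<otimes> (k \<otimes> inv t) = l \<otimes> m"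
  shows "amalgamated t \<and> amalgamated (inv t)"
proof -
  have car: "t \<in> carrier G" "k \<in> carrier G" "l \<in> carrier G" "m \<in> carrier G"
    using assms S_carrier by auto
  have e': "t \<otimes> (inv k \<otimes> inv t) = inv m \<otimes> inv l"
    using arg_cong[OF e, of "m_inv G"] car by (simp add: inv_mult_group m_assoc)
  have "l = m"
  proof (rule ccontr)
    assume "l \<noteq> m"
    then have "l \<otimes> m = \<one>"
      using k by auto
    then have "k \<otimes> inv t = inv t"
      using e car by (intro eq_inv_of_mult_eq_one) simp_all
    then have "k = \<one>"
      using car by (simp add: r_cancel_one)
    then show False
      using k by auto
  qed
  then obtain c where "c \<in> {h, inv h}" "t \<otimes> h \<otimes> inv t = c \<otimes> c"
    using e e' k car by (cases "k = h") (force simp: m_assoc)+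
  then show ?thesis
    using amalgamated_conj_square t by blast
qed

text \<open>Apart from impossible short cases, the relator read cyclically has a single-letter block
  between \<open>t\<close> and \<open>inv t\<close> and one between \<open>inv t\<close> and
  \<open>t\<close>. The exception is \<open>k t p (inv t) p'\<close>, whose outer letters merge into
  a block of two; it is a conjugation relation.\<close>

lemma linked_alt_word_1:
  assumes w: "simple_relator w" "w @ z = replicate j k @ t # alt_word 1 (inv t) ks"
    and j: "j \<le> 1" and k: "k \<in> {h, inv h}" "set ks \<subseteq> {h, inv h}"
    and t: "t \<in> S" "t \<notin> commuting" and len: "length w \<le> r"
  shows "(t \<leadsto> h \<otimes> t \<and> inv t \<leadsto> h \<otimes> inv t) \<or> (amalgamated t \<and> amalgamated (inv t))"
proof -
  define a where "a = replicate j k"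
  have a: "set a \<subseteq> {h, inv h}" "a = [] \<or> a = [k]"
    using j k unfolding a_def by (auto simp: le_Suc_eq)
  have car: "t \<in> carrier G" "inv t \<in> S" "inv (inv t) = t" "k \<in> carrier G"
    using t k S_inv[OF t(1)] S_carrier by auto
  have HS: "{h, inv h} \<subseteq> S" "{h, inv h} \<subseteq> carrier G"
    using h_S inv_h_S by auto
  have w1: "w \<noteq> []" "word_prod w = \<one>"
    using w by (auto simp: simple_relator_def)
  have "w @ z = a @ t # alt_word 1 (inv t) ks"
    using w(2) a_def by simp
  then obtain w' where w': "w = a @ w'" "w' @ z = t # alt_word 1 (inv t) ks"
    using a w1 k by (auto simp: append_eq_Cons_conv)
  have two: "t \<leadsto> h \<otimes> t \<and> inv t \<leadsto> h \<otimes> inv t"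
    if "simple_relator (t # p # inv t # u)" "simple_relator (inv t # p' # t # u')"
      "p \<in> {h, inv h}" "p' \<in> {h, inv h}" "set u \<subseteq> S" "set u' \<subseteq> S" "length u + 3 \<le> r" "length u' + 3 \<le> r"
    for p p' u u'
    using linked_window_block[of t p u] linked_window_block[of "inv t" p' u'] that t car by simp
  note one = relator_one_letter_commuting[of a _ t]
  have wS: "set w \<subseteq> S"
  proof -
    have "set w' \<subseteq> set (t # alt_word 1 (inv t) ks)"
      unfolding w'(2)[symmetric] by simp
    then show ?thesis
      using set_alt_word[of "inv t" 1 ks] car t w' a k HS by auto
  qed
  from alt_word_1_prefix[OF car(1) w'(2)] show ?thesis
  proof cases
    case 1
    then have "w = [k]"
      using w' a w1 by auto
    then show ?thesis
      using w1 k car by auto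
  next
    case 2
    then show ?thesis
      using one[of "[]"] w1 w' a car t by simp
  next
    case (3 p)
    then show ?thesis
      using one[of "[p]"] w1 w' a car t k by auto
  next
    case (4 p)
    show ?thesis
    proof (cases "a = []")
      case True
      then have "t \<otimes> (p \<otimes> inv t) = \<one>"
        using w1 w' 4 car by simp
      moreover have p: "p \<in> {h, inv h}" "p \<in> carrier G"
        using 4 k HS by auto
      ultimately have "p \<otimes> inv t = inv t"
        using car by (intro eq_inv_of_mult_eq_one) simp_all
      then have "p = \<one>"
        using p car by (simp add: r_cancel_one)
      then show ?thesis
        using p by auto
    next
      case False
      then have s: "simple_relator (k # t # p # [inv t])"
        using w w' 4 a by simp
      then have "simple_relator (t # p # inv t # [k])"
        using simple_relator_rotate1[of k "[t, p, inv t]"] by simp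
      moreover have "simple_relator (inv t # k # t # [p])"
        using simple_relator_rotate[of "[k, t, p]" "[inv t]"] s by simp
      ultimately show ?thesis
        using two[of p "[k]" k "[p]"] 4 k HS r_ge by auto
    qed
  next
    case (5 p p')
    then have p: "p \<in> {h, inv h}" "p' \<in> {h, inv h}" "p \<in> carrier G" "p' \<in> carrier G"
      using k(2) HS by blast+
    show ?thesis
    proof (cases "a = []")
      case True
      then have s: "simple_relator (t # p # inv t # [p'])"
        using w w' 5 by simp
      have s': "simple_relator (inv t # p' # t # [p])"
        using simple_relator_rotate[of "[t, p]" "[inv t, p']"] s by simp
      have "t \<leadsto> h \<otimes> t \<and> inv t \<leadsto> h \<otimes> inv t"
        by (rule two[OF s s' p(1,2)]) (use p(1,2) HS r_ge in auto)
      then show ?thesis ..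
    next
      case False
      then have "k \<otimes> (t \<otimes> (p \<otimes> (inv t \<otimes> p'))) = \<one>"
        using w1 w' 5 a car p by simp
      then have "t \<otimes> (p \<otimes> inv t) \<otimes> p' = inv k"
        using car p by (intro eq_inv_of_mult_eq_one) (simp_all add: m_assoc)
      then have "t \<otimes> (p \<otimes> inv t) = inv k \<otimes> inv p'"
        using car p by (subst inv_solve_right) simp_all
      then show ?thesis
        using conj_square_cases[OF t p(1), of "inv k" "inv p'"] k(1) p(2) by auto
    qed
  next
    case (6 p p' u)
    have s: "simple_relator (a @ [t, p, inv t, p', t] @ u)"
      using w(1) w' 6 by simp
    have s1: "simple_relator (t # p # inv t # p' # t # u @ a)"
      using simple_relator_rotate[OF s] by simp
    have s2: "simple_relator (inv t # p' # t # u @ a @ [t, p])"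
      using simple_relator_rotate[of "a @ [t, p]" "[inv t, p', t] @ u"] s by simp
    have p: "p \<in> {h, inv h}" "p' \<in> {h, inv h}"
      using 6 k(2) by blast+
    have "set u \<subseteq> S" "set a \<subseteq> S" "p \<in> S" "p' \<in> S" "length u + length a + 5 \<le> r"
      using 6 w' wS len by auto
    then have "t \<leadsto> h \<otimes> t \<and> inv t \<leadsto> h \<otimes> inv t"
      by (intro two[OF s1 s2 p]) (use t in auto)
    then show ?thesis ..
  qed
qed

text \<open>Four windows are needed, at both ends of a block after \<open>t\<close> and of a block
  after \<open>inv t\<close>. Possible short relators contain them cyclically unless a block has
  shrunk to one letter, and then \<open>conj_square_cases\<close> applies.\<close>

lemma linked_alt_word_2:
  assumes w: "simple_relator w" "w @ z = replicate j k @ t # alt_word 2 (inv t) ks"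
    and j: "j \<le> 2" and k: "k \<in> {h, inv h}" "set ks \<subseteq> {h, inv h}"
    and t: "t \<in> S" "t \<notin> commuting" and len: "length w \<le> r"
  shows "(t \<leadsto> h \<otimes> h \<and> inv h \<leadsto> h \<otimes> t) \<and> (inv t \<leadsto> h \<otimes> h \<and> inv h \<leadsto> h \<otimes> inv t)"
proof -
  have car: "t \<in> carrier G" "inv t \<in> S" "inv (inv t) = t" "inv t \<in> carrier G" "inv t \<notin> commuting"
    using t k S_inv[OF t(1)] S_carrier by (auto simp: commuting_inv_iff)
  have HS: "{h, inv h} \<subseteq> S" "{h, inv h} \<subseteq> carrier G"
    using h_S inv_h_S by auto
  have w1: "w \<noteq> []" "word_prod w = \<one>"
    using w by (auto simp: simple_relator_def)
  have sq: "p \<otimes> p \<noteq> \<one>" if "p \<in> {h, inv h}" for p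
    using that h_not_involution inv_mult_group[of h h] inv_eq_1_iff[of "h \<otimes> h"] by auto
  \<comment> \<open>The relator cannot end within the initial block, since neither \<open>k\<close>
    nor its square is trivial.\<close>
  have "\<exists>w'. w = replicate j k @ w' \<and> w' @ z = t # alt_word 2 (inv t) ks"
  proof (rule ccontr)
    assume no: "\<not> ?thesis"
    have "\<exists>i \<le> 2. w = replicate i k"
    proof -
      obtain us where "w = replicate j k @ us \<and> us @ z = t # alt_word 2 (inv t) ks \<or>
          w @ us = replicate j k"
        using w(2) unfolding append_eq_append_conv2 by blast
      with no have "replicate j k = w @ us"
        by auto
      then have "w = replicate (length w) k" "length w \<le> j"
        by (metis append_eq_conv_conj length_append length_replicate le_add1 take_replicate min.absorb1)
          (metis \<open>replicate j k = w @ us\<close> le_add1 length_append length_replicate)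
      then show ?thesis
        using j by (metis order_trans)
    qed
    then obtain i where "i \<le> 2" "w = replicate i k" by blast
    then have "w = [k] \<or> w = [k, k]"
      using w1(1) by (auto simp: le_Suc_eq numeral_2_eq_2)
    then show False
      using w1 sq k HS by auto
  qed
  then obtain w' where w': "w = replicate j k @ w'" "w' @ z = t # alt_word 2 (inv t) ks"
    by blast
  have a: "set (replicate j k) \<subseteq> {h, inv h}"
    using k by auto
  have wS: "set w \<subseteq> S"
  proof -
    have "set w' \<subseteq> set (t # alt_word 2 (inv t) ks)"
      unfolding w'(2)[symmetric] by simp
    then show ?thesis
      using set_alt_word[of "inv t" 2 ks] car t w' a k HS by auto
  qed
  have two: ?thesis
    if "simple_relator (t # p # p # u1)" "simple_relator (p # p # inv t # u2)"
      "simple_relator (inv t # p' # p' # u3)" "simple_relator (p' # p' # t # u4)"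
      "p \<in> {h, inv h}" "p' \<in> {h, inv h}" "set u1 \<subseteq> S" "set u2 \<subseteq> S" "set u3 \<subseteq> S" "set u4 \<subseteq> S"
      "length u1 + 3 \<le> r" "length u2 + 3 \<le> r" "length u3 + 3 \<le> r" "length u4 + 3 \<le> r"
    for p p' u1 u2 u3 u4
    using linked_window_block_2[of t p u1 u2] linked_window_block_2[of "inv t" p' u3 u4] that t car
    by simp
  note one = relator_one_letter_commuting[of "replicate j k" _ t]
  \<comment> \<open>Two partial blocks of at most two letters may merge, hence
    \<open>m \<le> 4\<close> and total length at most 8. The case \<open>m = 0\<close> is
    impossible, \<open>m = 1\<close> is a conjugation relation for \<open>inv t\<close>, and from
    \<open>m = 2\<close> on all four windows exist.\<close>
  have main: ?thesis
    if s: "simple_relator ([t, p, p, inv t] @ replicate m q)" and m: "m \<le> 4"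
      and p: "p \<in> {h, inv h}" and q: "q \<in> {h, inv h}" for p q m
  proof -
    have pc: "p \<in> carrier G" "q \<in> carrier G" "p \<in> S" "q \<in> S"
      using p q HS by auto
    consider "m = 0" | "m = 1" | m' where "m = Suc (Suc m')"
      by (metis One_nat_def not0_implies_Suc)
    then show ?thesis
    proof cases
      case 1
      then have "t \<otimes> (p \<otimes> p \<otimes> inv t) = \<one>"
        using s car pc by (simp add: simple_relator_def m_assoc)
      then have "p \<otimes> p \<otimes> inv t = inv t"
        using car pc by (intro eq_inv_of_mult_eq_one) simp_all
      then have "p \<otimes> p = \<one>"
        using pc car by (simp add: r_cancel_one)
      then show ?thesis
        using sq p by auto
    next
      case 2
      then have "t \<otimes> (p \<otimes> p \<otimes> inv t \<otimes> q) = \<one>"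
        using s car pc by (simp add: simple_relator_def m_assoc)
      then have "p \<otimes> p \<otimes> inv t \<otimes> q = inv t"
        using car pc by (intro eq_inv_of_mult_eq_one) simp_all
      then have "inv t \<otimes> (inv q \<otimes> t) = p \<otimes> p \<otimes> inv t \<otimes> q \<otimes> (inv q \<otimes> t)"
        by simp
      then have "inv t \<otimes> (inv q \<otimes> t) = p \<otimes> p"
        using car pc by (simp add: m_assoc)
      then have "amalgamated (inv t) \<and> amalgamated (inv (inv t))"
        using conj_square_cases[of "inv t" "inv q" p p] car p q t by auto
      then show ?thesis
        using car by (auto simp: amalgamated_def)
    next
      case 3
      have m: "replicate m q = q # q # replicate m' q" "replicate m q = replicate m' q @ [q, q]"
        using 3 by (simp_all add: replicate_append_same[symmetric])
      have "simple_relator (t # p # p # inv t # replicate m q)"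
        using s by simp
      moreover have "simple_relator (p # p # inv t # replicate m q @ [t])"
        using simple_relator_rotate1[of t "[p, p, inv t] @ replicate m q"] s by simp
      moreover have "simple_relator (inv t # q # q # replicate m' q @ [t, p, p])"
        using simple_relator_rotate[of "[t, p, p]" "inv t # replicate m q"] s m by simp
      moreover have "simple_relator (q # q # t # [p, p, inv t] @ replicate m' q)"
        using simple_relator_rotate[of "[t, p, p, inv t] @ replicate m' q" "[q, q]"] s m(2) by simp
      ultimately show ?thesis
        by (rule two) (use p q pc t car r_ge \<open>m \<le> 4\<close> 3 in auto)
    qed
  qed
  from alt_word_2_prefix[OF car(1) w'(2)] show ?thesis
  proof cases
    case 1
    then have "w = replicate j k"
      using w' by simp
    then have "w = [k] \<or> w = [k, k]"
      using w1(1) j by (auto simp: le_Suc_eq numeral_2_eq_2)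
    then show ?thesis
      using w1 sq k HS by auto
  next
    case (2 i p)
    then have "set (replicate i p) \<subseteq> {h, inv h}"
      using k by auto
    then show ?thesis
      using one[of "replicate i p"] a w1 w' car t 2 by simp
  next
    case 3
    then show ?thesis
      using one[of "[]"] a w1 w' car t by simp
  next
    case (4 i p p')
    then have p: "p \<in> {h, inv h}" "p' \<in> {h, inv h}"
      using k(2) by blast+
    \<comment> \<open>Rotation moves the initial block next to the final partial block. Opposite
      signs there would give a trivial proper infix, so the two merge into a power of one
      letter.\<close>
    have s: "simple_relator ([t, p, p, inv t] @ replicate i p' @ replicate j k)"
      using simple_relator_rotate[of "replicate j k" w'] w w' 4 by simp
    show ?thesis
    proof (cases "i = 0 \<or> j = 0 \<or> p' = k")
      case True
      then have "replicate i p' @ replicate j k = replicate (i + j) (if i = 0 then k else p')"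
        by (auto simp: replicate_add)
      then show ?thesis
        using main[of p "i + j" "if i = 0 then k else p'"] s p k j 4 by auto
    next
      case False
      then obtain i' j' where ij: "i = Suc i'" "j = Suc j'"
        by (metis not0_implies_Suc)
      have "[t, p, p, inv t] @ replicate i p' @ replicate j k =
          ([t, p, p, inv t] @ replicate i' p') @ [p', k] @ replicate j' k"
        using ij by (simp add: replicate_append_same[symmetric])
      moreover have "word_prod [p', k] = \<one>"
        using False p k by auto
      ultimately have False
        using simple_relator_proper_infix[OF s] by blast
      then show ?thesis ..
    qed
  next
    case (5 p)
    then show ?thesis
      using main[of p j k] simple_relator_rotate[of "replicate j k" w'] w w' j k by auto
  next
    case (6 p p' u)
    then have p: "p \<in> {h, inv h}" "p' \<in> {h, inv h}"
      using k(2) by blast+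
    let ?a = "replicate j k"
    have s: "simple_relator (?a @ [t, p, p, inv t, p', p', t] @ u)"
      using w(1) w' 6 by simp
    have s1: "simple_relator (t # p # p # [inv t, p', p', t] @ u @ ?a)"
      using simple_relator_rotate[OF s] by simp
    have s2: "simple_relator (p # p # inv t # [p', p', t] @ u @ ?a @ [t])"
      using simple_relator_rotate[of "?a @ [t]" "[p, p, inv t, p', p', t] @ u"] s by simp
    have s3: "simple_relator (inv t # p' # p' # [t] @ u @ ?a @ [t, p, p])"
      using simple_relator_rotate[of "?a @ [t, p, p]" "[inv t, p', p', t] @ u"] s by simp
    have s4: "simple_relator (p' # p' # t # u @ ?a @ [t, p, p, inv t])"
      using simple_relator_rotate[of "?a @ [t, p, p, inv t]" "[p', p', t] @ u"] s by simp
    have S': "set u \<subseteq> S" "set ?a \<subseteq> S" "p \<in> S" "p' \<in> S" "length u + j + 7 \<le> r"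
      using wS w' 6 len p HS a by auto
    show ?thesis
      by (rule two[OF s1 s2 s3 s4 p]) (use S' t car in auto)
  qed
qed

section \<open>From nilpotency to a connected connectivity graph\<close>

lemma amalgamated_nilpotent:
  assumes nil: "nilpotent_class_le G n" "n \<ge> 1" and r: "2 ^ (n + 2) \<le> r" and s: "s \<in> S"
    and ne: "s \<notin> {h, inv h, h \<otimes> h, inv (h \<otimes> h)}"
  shows "amalgamated s"
proof (cases "s \<in> commuting")
  case True
  then show ?thesis
    using amalgamated_commuting[OF s _ ne] by (simp add: commuting_def)
next
  case False
  have car: "s \<in> carrier G" "inv s \<in> S" "inv (inv s) = s" "inv s \<notin> commuting"
    using s S_inv[OF s] S_carrier False by (auto simp: commuting_inv_iff)
  have relator: "\<exists>w z j k t ks. simple_relator w \<and> w @ z = replicate j k @ t # alt_word q (inv t) ks \<and>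
      j \<le> q \<and> k \<in> {h, inv h} \<and> set ks \<subseteq> {h, inv h} \<and> t \<in> {s, inv s} \<and> length w \<le> r"
    if q: "q \<le> 2" and ns: "\<not> equiv_inv G (h [^] q) s" for q
  proof -
    obtain ks where ks: "length ks = 2 ^ n" "set ks \<subseteq> {h, inv h}"
      "word_prod (alt_word q (inv s) ks) = iter_comm G n (h [^] q) s"
      using iter_comm_alt_word[of h s n q] car nil by auto
    let ?W = "alt_word q (inv s) ks"
    have one: "word_prod ?W = \<one>"
      using ks nil(1) ns car unfolding nilpotent_class_le_def by auto
    have len: "length ?W = Suc q * 2 ^ n"
      using ks by (simp add: length_alt_word)
    have "set ks \<subseteq> carrier G"
      using ks by auto
    then have "set ?W \<subseteq> carrier G"
      using set_alt_word[of "inv s" q ks] car by auto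
    moreover have "?W \<noteq> []"
      using len by (metis length_0_conv mult_eq_0_iff nat.distinct(1) power_not_zero zero_neq_numeral)
    ultimately obtain x w z where w: "?W = x @ w @ z" "simple_relator w"
      using ex_simple_relator_infix one by blast
    have "w @ z \<noteq> []"
      using w by (auto simp: simple_relator_def)
    then obtain j k t ks' where j: "j \<le> q" "w @ z = replicate j k @ t # alt_word q (inv t) ks'"
      "k \<in> set ks" "set ks' \<subseteq> set ks" "t \<in> {inv s, inv (inv s)}"
      using alt_word_suffix[of "inv s" q ks x "w @ z"] w car by auto
    have "length w \<le> length ?W"
      unfolding w by simp
    \<comment> \<open>The larger length, at \<open>q = 2\<close>, is \<open>3 * 2 ^ n\<close>; the
      bound used for each \<open>q\<close> is \<open>4 * 2 ^ n = 2 ^ (n + 2)\<close>.\<close>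
    also have "\<dots> \<le> 4 * 2 ^ n"
      unfolding len using q by (intro mult_right_mono) auto
    also have "\<dots> \<le> r"
      using r by (simp add: power_add mult.commute)
    finally have "length w \<le> r" .
    moreover have "t \<in> {s, inv s}" "k \<in> {h, inv h}" "set ks' \<subseteq> {h, inv h}"
      using j car ks by auto
    ultimately show ?thesis
      using w(2) j by blast
  qed
  \<comment> \<open>Excluding \<open>h\<close> and \<open>inv h\<close> makes the commutator of
    \<open>h\<close> and \<open>s\<close> trivial; excluding \<open>h \<otimes> h\<close> and its
    inverse does the same for the square below.\<close>
  have "\<not> equiv_inv G (h [^] (1 :: nat)) s"
    using ne car by (auto simp: equiv_inv_def)
  then obtain w z j k t ks where w: "simple_relator w"
    "w @ z = replicate j k @ t # alt_word 1 (inv t) ks"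
    "j \<le> 1" "k \<in> {h, inv h}" "set ks \<subseteq> {h, inv h}" and t: "t \<in> {s, inv s}" and "length w \<le> r"
    using relator[of 1] by auto
  then have "(t \<leadsto> h \<otimes> t \<and> inv t \<leadsto> h \<otimes> inv t) \<or> (amalgamated t \<and> amalgamated (inv t))"
    using linked_alt_word_1[OF w] s car False by blast
  \<comment> \<open>The letter \<open>t\<close> found may be \<open>inv s\<close>, which is why the
    links were proved for \<open>t\<close> and \<open>inv t\<close> together.\<close>
  then have 1: "s \<leadsto> h \<otimes> s"
    using t car by (auto simp: amalgamated_def)
  have "\<not> equiv_inv G (h [^] (2 :: nat)) s"
    using ne car by (auto simp: equiv_inv_def numeral_2_eq_2)
  then obtain w z j k t ks where w: "simple_relator w"
    "w @ z = replicate j k @ t # alt_word 2 (inv t) ks"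
    "j \<le> 2" "k \<in> {h, inv h}" "set ks \<subseteq> {h, inv h}" and t: "t \<in> {s, inv s}" and "length w \<le> r"
    using relator[of 2] by auto
  then have "(t \<leadsto> h \<otimes> h \<and> inv h \<leadsto> h \<otimes> t) \<and> (inv t \<leadsto> h \<otimes> h \<and> inv h \<leadsto> h \<otimes> inv t)"
    using linked_alt_word_2[OF w] s car False by blast
  then have "s \<leadsto> h \<otimes> h \<and> inv h \<leadsto> h \<otimes> s"
    using t car by auto
  with 1 show ?thesis
    by (simp add: amalgamated_def)
qed

text \<open>Every neighbour is \<open>s\<close> or \<open>h \<otimes> s\<close> with
  \<open>s\<close> in \<open>S\<close>. Those not covered by \<open>amal\<close> are
  \<open>inv h\<close> itself, \<open>h \<otimes> h\<close>, which the element \<open>t\<close>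
  links to \<open>inv h\<close>, or reached by a triangle.\<close>

lemma linked_of_amalgamated:
  assumes amal: "\<And>s. s \<in> S \<Longrightarrow> s \<notin> {h, inv h, h \<otimes> h, inv (h \<otimes> h)} \<Longrightarrow> amalgamated s"
    and t: "t \<in> S" "t \<notin> {h, inv h, h \<otimes> h, inv (h \<otimes> h)}"
    and a: "a \<in> nbhd (carrier G) (cayley_adj G S) {\<one>, h}"
  shows "inv h \<leadsto> a"
proof -
  have hh: "inv h \<leadsto> h \<otimes> h"
    using amalgamatedD(3) amal[OF t] by blast
  have a': "a \<in> carrier G" "a \<noteq> \<one>" "a \<noteq> h" "cayley_adj G S \<one> a \<or> cayley_adj G S h a"
    using a by (auto simp: nbhd_def)
  have adj: "\<exists>s \<in> S. a = x \<otimes> s" if "cayley_adj G S x a" "x \<in> carrier G" for x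
  proof -
    from that(1) consider s where "s \<in> S" "a = x \<otimes> s" | s where "s \<in> S" "x = a \<otimes> s"
      unfolding cayley_adj_def by blast
    then show ?thesis
    proof cases
      case 2
      then have "a = x \<otimes> inv s"
        using a' S_carrier by (auto simp: m_assoc)
      then show ?thesis
        using S_inv[OF 2(1)] by blast
    qed blast
  qed
  from a'(4) show ?thesis
  proof
    assume "cayley_adj G S \<one> a"
    then have aS: "a \<in> S"
      using adj[of \<one>] S_carrier by auto
    consider "a = inv h" | "a = h \<otimes> h" | "a = inv (h \<otimes> h)" | "a \<notin> {h, inv h, h \<otimes> h, inv (h \<otimes> h)}"
      using a' by blast
    then show ?thesis
    proof cases
      case 3
      \<comment> \<open>The triangle on \<open>\<one>\<close>, \<open>inv h\<close> and
        \<open>inv h \<otimes> inv h\<close>, whose last edge exists because \<open>S\<close>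
        contains \<open>h \<otimes> h\<close>.\<close>
      have "\<one> \<otimes> inv h \<leadsto> \<one> \<otimes> inv h \<otimes> word_prod [inv h]"
        by (rule linked_walk[where y = \<one> and c = "h \<otimes> h"])
          (use a' 3 S_inv[OF aS] inv_h_S r_ge in \<open>auto simp: m_assoc inv_mult_group\<close>)
      then show ?thesis
        using 3 by (simp add: inv_mult_group)
    next
      case 4
      then show ?thesis
        using amalgamatedD(1) amal[OF aS] by blast
    qed (use hh in auto)
  next
    assume "cayley_adj G S h a"
    then obtain s where s: "s \<in> S" "a = h \<otimes> s"
      using adj[of h] by auto
    consider "s = h" | "s = inv h" | "s = h \<otimes> h" | "s = inv (h \<otimes> h)"
      | "s \<notin> {h, inv h, h \<otimes> h, inv (h \<otimes> h)}"
      by blast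
    then show ?thesis
    proof cases
      case 3
      \<comment> \<open>A triangle at \<open>h\<close>, with further vertices
        \<open>h \<otimes> h\<close> and \<open>h \<otimes> h \<otimes> h\<close>.\<close>
      have "h \<otimes> h \<leadsto> h \<otimes> h \<otimes> word_prod [h]"
        by (rule linked_walk[where y = h and c = "inv (h \<otimes> h)"])
          (use a' 3 s S_inv[OF s(1)] h_S r_ge h_not_involution in \<open>auto simp: m_assoc inv_mult_group\<close>)
      then show ?thesis
        using 3 s hh by (simp add: m_assoc)
    next
      case 4
      then show ?thesis
        using s by (simp add: inv_mult_group)
    next
      case 5
      then show ?thesis
        using amalgamatedD(2) amal[OF s(1)] s(2) by blast
    qed (use hh s a' in auto)
  qed
qed

end

theorem theorem6p2:
  fixes G :: "('a, 'b) monoid_scheme" and S :: "'a set" and n r :: nat and h :: 'a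
  assumes "group G"
    and "n \<ge> 1"
    and "nilpotent_class_le G n"
    and "generating_set G S"
    and "\<one>\<^bsub>G\<^esub> \<notin> S"
    and "r \<ge> 2 ^ (n + 2)"
    and "h \<in> S"
    and "local_2_separator (carrier G) (cayley_adj G S) r \<one>\<^bsub>G\<^esub> h"
    and "\<forall>v\<in>carrier G. \<not> local_cutvertex (carrier G) (cayley_adj G S) r v"
    and "h \<otimes>\<^bsub>G\<^esub> h \<noteq> \<one>\<^bsub>G\<^esub>"
  shows "S \<subseteq> {h, inv\<^bsub>G\<^esub> h, h \<otimes>\<^bsub>G\<^esub> h, inv\<^bsub>G\<^esub> (h \<otimes>\<^bsub>G\<^esub> h)}"
proof (rule ccontr)
  assume "\<not> ?thesis"
  then obtain t where t: "t \<in> S"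
    "t \<notin> {h, inv\<^bsub>G\<^esub> h, h \<otimes>\<^bsub>G\<^esub> h, inv\<^bsub>G\<^esub> (h \<otimes>\<^bsub>G\<^esub> h)}"
    by blast
  have "(2 :: nat) ^ 3 \<le> 2 ^ (n + 2)"
    using assms(2) by (intro power_increasing) auto
  then have "8 \<le> r"
    using assms(6) by simp
  then interpret cayley_edge G S h r
    using assms by (intro cayley_edge.intro cayley_edge_axioms.intro) (auto simp: generating_set_def)
  have "linked (inv\<^bsub>G\<^esub> h) a" if "a \<in> nbhd (carrier G) (cayley_adj G S) {\<one>\<^bsub>G\<^esub>, h}" for a
    using linked_of_amalgamated[OF amalgamated_nilpotent[OF assms(3,2,6)] t that] by blast
  then have "linked a b" if "a \<in> nbhd (carrier G) (cayley_adj G S) {\<one>\<^bsub>G\<^esub>, h}"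
    "b \<in> nbhd (carrier G) (cayley_adj G S) {\<one>\<^bsub>G\<^esub>, h}" for a b
    using linked_trans linked_sym that by blast
  then show False
    using assms(8) unfolding local_2_separator_def by blast
qed

end
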